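(* Let $\mathbb{F}\in\{\mathbb{R},\mathbb{C},\mathbb{H}\}$. (1) Let $A=\operatorname{Arrow}(D,u,v,\alpha)\in\mathbb{F}^{n\times n}$ be an arrowhead matrix with the tip at position $A_{ii}=\alpha$, where $1\le i\le n$, and let $z\in\mathbb{F}^n$. Then $w=Az$ is given by $$ \begin{aligned} w_j&=d_jz_j+u_jz_i, && j=1,2,\dots,i-1,\\ w_i&=v_{1:i-1}^\star z_{1:i-1}+\alpha z_i+v_{i:n-1}^\star z_{i+1:n},\\ w_j&=u_{j-1}z_i+d_{j-1}z_j, && j=i+1,i+2,\dots,n. \end{aligned} $$ (2) Let $A=\operatorname{DPR1}(\Delta,x,y,\rho)\in\mathbb{F}^{n\times n}$ be a diagonal-plus-rank-one matrix, let $z\in\mathbb{F}^n$, and let $\beta=\rho\,(y^\star z)$. Then $w=Az$ is given by $$ w_i=\delta_iz_i+x_i\beta,\qquad i=1,2,\dots,n. $$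
   Context: $\mathbb{H}$ is the (non-commutative) skew field of real quaternions; products are taken in the order written. $\star$ denotes the transpose of a real matrix, the conjugate transpose of a complex or quaternionic matrix or vector, and the conjugate of a scalar. For a vector $a$, $a_{k:l}$ denotes the subvector $(a_k,\dots,a_l)$ (empty if $k>l$, in which case the corresponding product is $0$). Arrowhead matrix: given a diagonal matrix $D$ of order $n-1$ with diagonal elements $d_1,\dots,d_{n-1}\in\mathbb{F}$, vectors $u,v\in\mathbb{F}^{n-1}$ and $\alpha\in\mathbb{F}$, $\operatorname{Arrow}(D,u,v,\alpha)$ is the matrix $\begin{bmatrix} D & u\\ v^\star & \alpha\end{bmatrix}\in\mathbb{F}^{n\times n}$ or a symmetric permutation of it. The arrowhead matrix with the tip at position $(i,i)$ is obtained by moving the last row and column to position $i$ while keeping the order of the others: $A_{ii}=\alpha$; for $j<i$, $A_{jj}=d_j$, $A_{ji}=u_j$, $A_{ij}=v_j^\star$; for $j>i$, $A_{jj}=d_{j-1}$, $A_{ji}=u_{j-1}$, $A_{ij}=v_{j-1}^\star$; all other entries are $0$. Diagonal-plus-rank-one matrix: $\operatorname{DPR1}(\Delta,x,y,\rho)=\Delta+x\rho y^\star$, where $\Delta\in\mathbb{F}^{n\times n}$ is diagonal with diagonal elements $\delta_1,\dots,\delta_n$, $x,y\in\mathbb{F}^n$ and $\rho\in\mathbb{F}$; its $(k,l)$ off-diagonal entry is $x_k\rho y_l^\star$. *)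

theory Defs
  imports "Jordan_Normal_Form.Matrix"
begin

section \<open>Real quaternions\<close>

text \<open>\<open>Quat a b c d\<close> stands for $a + b i + c j + d k$.\<close>

datatype quat = Quat (qre: real) (qi: real) (qj: real) (qk: real)

lemma quat_eq_iff: "p = q \<longleftrightarrow> qre p = qre q \<and> qi p = qi q \<and> qj p = qj q \<and> qk p = qk q"
  by (auto intro: quat.expand)

instantiation quat :: ab_group_add
begin

definition "0 = Quat 0 0 0 0"
definition "p + q = Quat (qre p + qre q) (qi p + qi q) (qj p + qj q) (qk p + qk q)"
definition "- p = Quat (- qre p) (- qi p) (- qj p) (- qk p)"
definition "p - q = Quat (qre p - qre q) (qi p - qi q) (qj p - qj q) (qk p - qk q)"

instance
  by intro_classes
    (simp_all add: quat_eq_iff zero_quat_def plus_quat_def uminus_quat_def minus_quat_def)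

end

text \<open>The Hamilton product, determined by $i^2 = j^2 = k^2 = ijk = -1$.\<close>

instantiation quat :: ring_1
begin

definition "1 = Quat 1 0 0 0"
definition "p * q = Quat
  (qre p * qre q - qi p * qi q - qj p * qj q - qk p * qk q)
  (qre p * qi q + qi p * qre q + qj p * qk q - qk p * qj q)
  (qre p * qj q - qi p * qk q + qj p * qre q + qk p * qi q)
  (qre p * qk q + qi p * qj q - qj p * qi q + qk p * qre q)"

instance
  by intro_classes
    (simp_all add: quat_eq_iff zero_quat_def plus_quat_def one_quat_def times_quat_def
      algebra_simps)

end

lemma quat_units:
  "Quat 0 1 0 0 * Quat 0 1 0 0 = - 1"
  "Quat 0 0 1 0 * Quat 0 0 1 0 = - 1"
  "Quat 0 0 0 1 * Quat 0 0 0 1 = - 1"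
  "Quat 0 1 0 0 * Quat 0 0 1 0 = Quat 0 0 0 1"
  "Quat 0 0 1 0 * Quat 0 1 0 0 = - Quat 0 0 0 1"
  by (simp_all add: quat_eq_iff one_quat_def times_quat_def uminus_quat_def)

instantiation quat :: conjugate
begin

definition "conjugate p = Quat (qre p) (- qi p) (- qj p) (- qk p)"

instance
  by intro_classes (auto simp: conjugate_quat_def quat_eq_iff)

end

lemma conjugate_quat_mult: "conjugate (p * q) = conjugate q * conjugate (p :: quat)"
  by (simp add: quat_eq_iff conjugate_quat_def times_quat_def algebra_simps)

instantiation quat :: division_ring
begin

definition "inverse p =
  (let r = (qre p)\<^sup>2 + (qi p)\<^sup>2 + (qj p)\<^sup>2 + (qk p)\<^sup>2
   in Quat (qre p / r) (- qi p / r) (- qj p / r) (- qk p / r))"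
definition "p div q = p * inverse (q :: quat)"

instance
proof
  fix p q :: quat
  let ?r = "(qre p)\<^sup>2 + (qi p)\<^sup>2 + (qj p)\<^sup>2 + (qk p)\<^sup>2"
  show "inverse (0 :: quat) = 0"
    by (simp add: zero_quat_def inverse_quat_def)
  show "p div q = p * inverse q"
    by (rule divide_quat_def)
  assume "p \<noteq> 0"
  then have "?r \<noteq> 0"
    by (auto simp: quat_eq_iff zero_quat_def add_nonneg_eq_0_iff)
  then have one: "(qre p)\<^sup>2 / ?r + (qi p)\<^sup>2 / ?r + (qj p)\<^sup>2 / ?r + (qk p)\<^sup>2 / ?r = 1"
    by (simp add: add_divide_distrib [symmetric])
  show "inverse p * p = 1" "p * inverse p = 1"
    using one
    by (simp_all add: quat_eq_iff one_quat_def times_quat_def inverse_quat_def Let_def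
        power2_eq_square mult.commute)
qed

end

section \<open>Arrowhead and diagonal-plus-rank-one matrices\<close>

text \<open>
  Indices start at 0. The scalar product \<open>\<bullet>\<close> multiplies in the order written, so $v^\star z$ is
  \<open>conjugate v \<bullet> z\<close>; \<open>conjugate\<close> is the identity on the reals. The library's \<open>\<bullet>c\<close> is not used: it
  puts the conjugate on the right factor, which matters over the quaternions.
\<close>

text \<open>Half-open range: entries \<open>k, \<dots>, l - 1\<close>, empty if \<open>l \<le> k\<close>.\<close>

definition subvec :: "'a vec \<Rightarrow> nat \<Rightarrow> nat \<Rightarrow> 'a vec" where
  "subvec a k l = vec (l - k) (\<lambda>j. a $ (k + j))"

definition arrow ::
  "'a :: {zero, conjugate} mat \<Rightarrow> 'a vec \<Rightarrow> 'a vec \<Rightarrow> 'a \<Rightarrow> 'a mat" where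
  "arrow D u v \<alpha> =
     four_block_mat D (mat_of_cols (dim_vec u) [u])
       (mat_of_row (conjugate v)) (mat 1 1 (\<lambda>_. \<alpha>))"

text \<open>
  \<open>arrow_tip i D u v \<alpha>\<close> is \<open>arrow D u v \<alpha>\<close> with its last row and column moved to position \<open>i\<close>, the
  order of the others being kept; \<open>tip_index n i k\<close> is the original index of the row (column)
  that ends up at position \<open>k\<close>.
\<close>

definition tip_index :: "nat \<Rightarrow> nat \<Rightarrow> nat \<Rightarrow> nat" where
  "tip_index n i k = (if k < i then k else if k = i then n - 1 else k - 1)"

definition arrow_tip ::
  "nat \<Rightarrow> 'a :: {zero, conjugate} mat \<Rightarrow> 'a vec \<Rightarrow> 'a vec \<Rightarrow> 'a \<Rightarrow> 'a mat" where
  "arrow_tip i D u v \<alpha> =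
     (let n = dim_vec u + 1
      in mat n n (\<lambda>(k, l). arrow D u v \<alpha> $$ (tip_index n i k, tip_index n i l)))"

lemma arrow_tip_entries:
  fixes D :: "'a :: {zero, conjugate} mat" and \<alpha> :: 'a
  assumes "i < n" "D \<in> carrier_mat (n - 1) (n - 1)" "diagonal_mat D"
    and "u \<in> carrier_vec (n - 1)" "v \<in> carrier_vec (n - 1)"
  defines "A \<equiv> arrow_tip i D u v \<alpha>"
  shows "A \<in> carrier_mat n n"
    and "A $$ (i, i) = \<alpha>"
    and "j < i \<Longrightarrow> A $$ (j, j) = D $$ (j, j)"
    and "j < i \<Longrightarrow> A $$ (j, i) = u $ j"
    and "j < i \<Longrightarrow> A $$ (i, j) = conjugate (v $ j)"
    and "i < j \<Longrightarrow> j < n \<Longrightarrow> A $$ (j, j) = D $$ (j - 1, j - 1)"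
    and "i < j \<Longrightarrow> j < n \<Longrightarrow> A $$ (j, i) = u $ (j - 1)"
    and "i < j \<Longrightarrow> j < n \<Longrightarrow> A $$ (i, j) = conjugate (v $ (j - 1))"
    and "k < n \<Longrightarrow> l < n \<Longrightarrow> k \<noteq> i \<Longrightarrow> l \<noteq> i \<Longrightarrow> k \<noteq> l \<Longrightarrow> A $$ (k, l) = 0"
  using assms(1-5) unfolding A_def
  by (auto simp: arrow_tip_def arrow_def tip_index_def mat_of_cols_def mat_of_row_def
      diagonal_mat_def)

definition dpr1 ::
  "'a :: {semiring_0, conjugate} mat \<Rightarrow> 'a vec \<Rightarrow> 'a vec \<Rightarrow> 'a \<Rightarrow> 'a mat" where
  "dpr1 \<Delta> x y \<rho> =
     \<Delta> + mat_of_cols (dim_vec x) [x] * mat 1 1 (\<lambda>_. \<rho>) * mat_of_row (conjugate y)"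

lemma dpr1_entries:
  assumes "\<Delta> \<in> carrier_mat n n" "x \<in> carrier_vec n" "y \<in> carrier_vec n"
  shows "dpr1 \<Delta> x y \<rho> \<in> carrier_mat n n"
    and "k < n \<Longrightarrow> l < n \<Longrightarrow>
      dpr1 \<Delta> x y \<rho> $$ (k, l) = \<Delta> $$ (k, l) + x $ k * \<rho> * conjugate (y $ l)"
  using assms
  by (auto simp: dpr1_def mat_of_cols_def mat_of_row_def scalar_prod_def)

end

theory Submission
  imports Defs
begin

text \<open>Each entry of \<open>w\<close> is a row of the matrix times \<open>z\<close>, so the
  formulas follow from the sparsity of the rows. In an arrowhead matrix, row k away from the tip
  \<open>i\<close> can be nonzero only in columns k and \<open>i\<close>, which leaves two terms.
  The tip row is full; cutting its sum just before and just after column \<open>i\<close> gives two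
  scalar products around \<alpha> times the tip entry of \<open>z\<close>. In the rank-one case, row
  i splits into a diagonal part with a single term and a part in which the i-th entry of
  \<open>x\<close> times \<rho> is a common left factor. Since quaternions do not commute, all this
  is done in \<open>arrow_tip_mult_vec\<close> and \<open>dpr1_mult_vec\<close> over a semiring
  whose multiplication need not commute; the three scalar fields are instances.\<close>

lemma sum_eq_two_terms:
  fixes f :: "'a \<Rightarrow> 'b :: comm_monoid_add"
  assumes "finite S" "a \<in> S" "b \<in> S" "a \<noteq> b" "\<And>k. k \<in> S \<Longrightarrow> k \<noteq> a \<Longrightarrow> k \<noteq> b \<Longrightarrow> f k = 0"
  shows "sum f S = f a + f b"
proof -
  have "sum f S = sum f {a, b}"
    by (rule sum.mono_neutral_right) (use assms in auto)
  then show ?thesis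
    using assms(4) by simp
qed

lemma index_mult_mat_vec_sum:
  assumes "A \<in> carrier_mat m n" "z \<in> carrier_vec n" "j < m"
  shows "(A *\<^sub>v z) $ j = (\<Sum>k = 0..<n. A $$ (j, k) * z $ k)"
  using assms by (auto simp: scalar_prod_def intro!: sum.cong)

text \<open>The two offsets are independent because, beyond the tip, entry \<open>i + j\<close> of
  \<open>v\<close> meets entry \<open>i + 1 + j\<close> of \<open>z\<close>. The scalar product sums
  over the dimension of its right factor; equal lengths keep these indices in range for the left
  factor.\<close>

lemma conjugate_subvec_scalar_prod:
  fixes v z :: "'a :: {semiring_0, conjugate} vec"
  assumes "l - k = l' - k'"
  shows "conjugate (subvec v k l) \<bullet> subvec z k' l' =
    (\<Sum>j = 0..<l' - k'. conjugate (v $ (k + j)) * z $ (k' + j))"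
  using assms by (simp add: scalar_prod_def subvec_def)

lemma arrow_tip_mult_vec:
  fixes D :: "'a :: {semiring_0, conjugate} mat" and \<alpha> :: 'a
  assumes i: "i < n" and D: "D \<in> carrier_mat (n - 1) (n - 1)" "diagonal_mat D"
    and u: "u \<in> carrier_vec (n - 1)" and v: "v \<in> carrier_vec (n - 1)" and z: "z \<in> carrier_vec n"
  defines "w \<equiv> arrow_tip i D u v \<alpha> *\<^sub>v z"
  shows "w \<in> carrier_vec n"
    and "j < i \<Longrightarrow> w $ j = D $$ (j, j) * z $ j + u $ j * z $ i"
    and "w $ i = conjugate (subvec v 0 i) \<bullet> subvec z 0 i + \<alpha> * z $ i
                + conjugate (subvec v i (n - 1)) \<bullet> subvec z (i + 1) n"
    and "i < j \<Longrightarrow> j < n \<Longrightarrow> w $ j = u $ (j - 1) * z $ i + D $$ (j - 1, j - 1) * z $ j"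
proof -
  let ?A = "arrow_tip i D u v \<alpha>"
  note A = arrow_tip_entries [OF i D u v, where \<alpha> = \<alpha>]
  show "w \<in> carrier_vec n"
    using A(1) z by (simp add: w_def)
  have w: "w $ k = (\<Sum>l = 0..<n. ?A $$ (k, l) * z $ l)" if "k < n" for k
    unfolding w_def using A(1) z that by (rule index_mult_mat_vec_sum)
  \<comment> \<open>Off the tip, only the diagonal entry and the one in the tip column survive;
    \<open>k \<noteq> i\<close> makes these two different columns.\<close>
  have off_tip: "w $ k = ?A $$ (k, k) * z $ k + ?A $$ (k, i) * z $ i" if "k < n" "k \<noteq> i" for k
    unfolding w [OF that(1)] by (rule sum_eq_two_terms) (use that i A(9) in auto)
  show "w $ j = D $$ (j, j) * z $ j + u $ j * z $ i" if "j < i"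
    using off_tip [of j] that i A(3,4) by simp
  show "w $ j = u $ (j - 1) * z $ i + D $$ (j - 1, j - 1) * z $ j" if "i < j" "j < n"
    using off_tip [of j] that A(6,7) by (simp add: add.commute)
  let ?f = "\<lambda>l. ?A $$ (i, l) * z $ l"
  \<comment> \<open>The tip row is cut at column \<open>i\<close>: the columns to the left, the tip
    itself, and the columns to the right.\<close>
  have "w $ i = sum ?f {0..<i} + sum ?f {i..<n}"
    unfolding w [OF i] by (rule sum.atLeastLessThan_concat [symmetric]) (use i in simp_all)
  also have "sum ?f {i..<n} = ?f i + sum ?f {i + 1..<n}"
    using i by (simp add: sum.atLeast_Suc_lessThan)
  also have "?f i = \<alpha> * z $ i"
    using A(2) by simp
  also have "sum ?f {0..<i} = conjugate (subvec v 0 i) \<bullet> subvec z 0 i"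
    by (simp add: conjugate_subvec_scalar_prod A(5))
  \<comment> \<open>Reindexing from 0 exposes the shift by one: the tip takes up position
    \<open>i\<close>, so column \<open>i + 1 + j\<close> holds the conjugate of
    \<open>v $ (i + j)\<close>. Both subvectors then have length \<open>n - 1 - i\<close>.\<close>
  also have "sum ?f {i + 1..<n} = (\<Sum>j = 0..<n - (i + 1). ?f (i + 1 + j))"
    by (simp add: sum.atLeastLessThan_shift_0 [of _ "Suc i"])
  also have "\<dots> = conjugate (subvec v i (n - 1)) \<bullet> subvec z (i + 1) n"
    by (auto simp: conjugate_subvec_scalar_prod A(8) intro!: sum.cong)
  finally show "w $ i = conjugate (subvec v 0 i) \<bullet> subvec z 0 i + \<alpha> * z $ i
                + conjugate (subvec v i (n - 1)) \<bullet> subvec z (i + 1) n"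
    by (simp add: add.assoc)
qed

text \<open>Associativity and distributivity suffice to collect the rank-one part into one scalar,
  \<rho> times the product of \<open>conjugate y\<close> and \<open>z\<close>. It is the same for
  every row and stays to the right of \<open>x $ i\<close>.\<close>

lemma dpr1_mult_vec:
  fixes \<Delta> :: "'a :: {semiring_0, conjugate} mat" and \<rho> :: 'a
  assumes \<Delta>: "\<Delta> \<in> carrier_mat n n" "diagonal_mat \<Delta>"
    and x: "x \<in> carrier_vec n" and y: "y \<in> carrier_vec n" and z: "z \<in> carrier_vec n"
  shows "dpr1 \<Delta> x y \<rho> *\<^sub>v z \<in> carrier_vec n"
    and "i < n \<Longrightarrow>
      (dpr1 \<Delta> x y \<rho> *\<^sub>v z) $ i = \<Delta> $$ (i, i) * z $ i + x $ i * (\<rho> * (conjugate y \<bullet> z))"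
proof -
  note A = dpr1_entries [OF \<Delta>(1) x y, where \<rho> = \<rho>]
  show "dpr1 \<Delta> x y \<rho> *\<^sub>v z \<in> carrier_vec n"
    using A(1) z by simp
  assume i: "i < n"
  have "(dpr1 \<Delta> x y \<rho> *\<^sub>v z) $ i =
      (\<Sum>k = 0..<n. (\<Delta> $$ (i, k) + x $ i * \<rho> * conjugate (y $ k)) * z $ k)"
    unfolding index_mult_mat_vec_sum [OF A(1) z i] by (rule sum.cong) (use i A(2) in auto)
  \<comment> \<open>Rebracketing to the right brings the factors that do not depend on
    \<open>k\<close> to the far left, where they can be pulled out of the sum without commuting
    anything.\<close>
  also have "\<dots> = (\<Sum>k = 0..<n. \<Delta> $$ (i, k) * z $ k)
      + (\<Sum>k = 0..<n. x $ i * (\<rho> * (conjugate (y $ k) * z $ k)))"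
    by (simp add: distrib_right sum.distrib mult.assoc)
  \<comment> \<open>As \<Delta> is diagonal, only \<open>k = i\<close> contributes.\<close>
  also have "(\<Sum>k = 0..<n. \<Delta> $$ (i, k) * z $ k) = (\<Sum>k \<in> {i}. \<Delta> $$ (i, k) * z $ k)"
    by (rule sum.mono_neutral_right) (use i \<Delta> in \<open>auto simp: diagonal_mat_def\<close>)
  also have "(\<Sum>k = 0..<n. x $ i * (\<rho> * (conjugate (y $ k) * z $ k))) =
      x $ i * (\<rho> * (conjugate y \<bullet> z))"
    using y z by (simp add: scalar_prod_def sum_distrib_left)
  finally show "(dpr1 \<Delta> x y \<rho> *\<^sub>v z) $ i = \<Delta> $$ (i, i) * z $ i + x $ i * (\<rho> * (conjugate y \<bullet> z))"
    by simp
qed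

theorem lemma1:
  shows "
    (\<forall>n i. \<forall>(D :: real mat) u v \<alpha> z w.
      i < n \<and> D \<in> carrier_mat (n - 1) (n - 1) \<and> diagonal_mat D \<and>
      u \<in> carrier_vec (n - 1) \<and> v \<in> carrier_vec (n - 1) \<and> z \<in> carrier_vec n \<and>
      w = arrow_tip i D u v \<alpha> *\<^sub>v z \<longrightarrow>
        w \<in> carrier_vec n \<and>
        (\<forall>j \<in> {0..<i}. w $ j = D $$ (j, j) * z $ j + u $ j * z $ i) \<and>
        w $ i = conjugate (subvec v 0 i) \<bullet> subvec z 0 i + \<alpha> * z $ i
                + conjugate (subvec v i (n - 1)) \<bullet> subvec z (i + 1) n \<and>
        (\<forall>j \<in> {i + 1..<n}. w $ j = u $ (j - 1) * z $ i + D $$ (j - 1, j - 1) * z $ j)) \<and>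
    (\<forall>n i. \<forall>(D :: complex mat) u v \<alpha> z w.
      i < n \<and> D \<in> carrier_mat (n - 1) (n - 1) \<and> diagonal_mat D \<and>
      u \<in> carrier_vec (n - 1) \<and> v \<in> carrier_vec (n - 1) \<and> z \<in> carrier_vec n \<and>
      w = arrow_tip i D u v \<alpha> *\<^sub>v z \<longrightarrow>
        w \<in> carrier_vec n \<and>
        (\<forall>j \<in> {0..<i}. w $ j = D $$ (j, j) * z $ j + u $ j * z $ i) \<and>
        w $ i = conjugate (subvec v 0 i) \<bullet> subvec z 0 i + \<alpha> * z $ i
                + conjugate (subvec v i (n - 1)) \<bullet> subvec z (i + 1) n \<and>
        (\<forall>j \<in> {i + 1..<n}. w $ j = u $ (j - 1) * z $ i + D $$ (j - 1, j - 1) * z $ j)) \<and>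
    (\<forall>n i. \<forall>(D :: quat mat) u v \<alpha> z w.
      i < n \<and> D \<in> carrier_mat (n - 1) (n - 1) \<and> diagonal_mat D \<and>
      u \<in> carrier_vec (n - 1) \<and> v \<in> carrier_vec (n - 1) \<and> z \<in> carrier_vec n \<and>
      w = arrow_tip i D u v \<alpha> *\<^sub>v z \<longrightarrow>
        w \<in> carrier_vec n \<and>
        (\<forall>j \<in> {0..<i}. w $ j = D $$ (j, j) * z $ j + u $ j * z $ i) \<and>
        w $ i = conjugate (subvec v 0 i) \<bullet> subvec z 0 i + \<alpha> * z $ i
                + conjugate (subvec v i (n - 1)) \<bullet> subvec z (i + 1) n \<and>
        (\<forall>j \<in> {i + 1..<n}. w $ j = u $ (j - 1) * z $ i + D $$ (j - 1, j - 1) * z $ j)) \<and>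
    (\<forall>n. \<forall>(\<Delta> :: real mat) x y \<rho> z \<beta> w.
      \<Delta> \<in> carrier_mat n n \<and> diagonal_mat \<Delta> \<and>
      x \<in> carrier_vec n \<and> y \<in> carrier_vec n \<and> z \<in> carrier_vec n \<and>
      \<beta> = \<rho> * (conjugate y \<bullet> z) \<and> w = dpr1 \<Delta> x y \<rho> *\<^sub>v z \<longrightarrow>
        w \<in> carrier_vec n \<and>
        (\<forall>i \<in> {0..<n}. w $ i = \<Delta> $$ (i, i) * z $ i + x $ i * \<beta>)) \<and>
    (\<forall>n. \<forall>(\<Delta> :: complex mat) x y \<rho> z \<beta> w.
      \<Delta> \<in> carrier_mat n n \<and> diagonal_mat \<Delta> \<and>
      x \<in> carrier_vec n \<and> y \<in> carrier_vec n \<and> z \<in> carrier_vec n \<and>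
      \<beta> = \<rho> * (conjugate y \<bullet> z) \<and> w = dpr1 \<Delta> x y \<rho> *\<^sub>v z \<longrightarrow>
        w \<in> carrier_vec n \<and>
        (\<forall>i \<in> {0..<n}. w $ i = \<Delta> $$ (i, i) * z $ i + x $ i * \<beta>)) \<and>
    (\<forall>n. \<forall>(\<Delta> :: quat mat) x y \<rho> z \<beta> w.
      \<Delta> \<in> carrier_mat n n \<and> diagonal_mat \<Delta> \<and>
      x \<in> carrier_vec n \<and> y \<in> carrier_vec n \<and> z \<in> carrier_vec n \<and>
      \<beta> = \<rho> * (conjugate y \<bullet> z) \<and> w = dpr1 \<Delta> x y \<rho> *\<^sub>v z \<longrightarrow>
        w \<in> carrier_vec n \<and>
        (\<forall>i \<in> {0..<n}. w $ i = \<Delta> $$ (i, i) * z $ i + x $ i * \<beta>))"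
  \<comment> \<open>Once \<open>w\<close> and \<beta> are replaced by their defining expressions,
    every conjunct is an instance of one of the two general lemmas at type \<open>real\<close>,
    \<open>complex\<close> or \<open>quat\<close>; what remains are their hypotheses and the index
    bounds.\<close>
  by (intro conjI allI impI ballI; elim conjE; hypsubst; intro arrow_tip_mult_vec dpr1_mult_vec) auto

end
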